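(* Let $m,n$ be positive integers with $$m>\prod_{p\le n,\ p \text{ prime}} p^{\lfloor \log_p n\rfloor}.$$ Then the binomial coefficient $\binom{m+n}{n}$ can be written as $$\binom{m+n}{n}=\prod_{i=1}^{n}a_i,$$ where $a_1,\dots,a_n$ are positive integers such that $a_i\mid (m+i)$ and $a_i>1$ for every $1\le i\le n$, and $\gcd(a_i,a_j)=1$ for all $1\le i\ne j\le n$.
   Context: $\lfloor x\rfloor$ denotes the largest integer not exceeding the real number $x$, and the product runs over all primes $p\le n$ (an empty product equals $1$). *)

theory Defs
  imports Complex_Main "HOL-Computational_Algebra.Primes"
begin

end

theory Submission
  imports Defs
begin

text \<open>
  For every prime \<open>p\<close> let \<open>g p\<close> be an index \<open>i \<in> {1..n}\<close> at which the \<open>p\<close>-adic valuation of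
  \<open>m + i\<close> is maximal. For \<open>j \<noteq> i\<close> the valuation of \<open>m + j\<close> is at most that of \<open>j - i\<close>, so the
  factors other than \<open>m + i\<close> contribute at most the valuation of \<open>(i - 1)! (n - i)!\<close>, which
  divides \<open>n!\<close>. Hence the whole \<open>p\<close>-part of the binomial coefficient divides \<open>m + g p\<close>, and
  \<open>a i\<close> is the product of the \<open>p\<close>-parts with \<open>g p = i\<close>. Since \<open>m + i\<close> exceeds
  \<open>lcm(1, \<dots>, n)\<close>, some prime power \<open>p ^ e > n\<close> divides \<open>m + i\<close>; this forces \<open>g p = i\<close>, and \<open>p\<close>
  divides the binomial coefficient because the \<open>p\<close>-part of \<open>i * (n choose i)\<close> is at most \<open>n\<close>.
\<close>

section \<open>Products of consecutive numbers and distances between indices\<close>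

lemma prod_dist_eq_fact:
  fixes i k :: nat
  assumes "i \<in> {1..k}"
  shows "(\<Prod>j\<in>{1..k} - {i}. (j - i) + (i - j)) = fact (i - 1) * fact (k - i)"
proof -
  \<comment> \<open>Under truncated subtraction \<open>(j - i) + (i - j)\<close> is the distance of
    \<open>i\<close> and \<open>j\<close>. Distances to smaller indices run through 1, ...,
    \<open>i - 1\<close>, those to larger ones through 1, ..., \<open>k - i\<close>.\<close>
  have split: "{1..k} - {i} = {1..<i} \<union> {i<..k}"
    using assms by auto
  have "(\<Prod>j\<in>{1..k} - {i}. (j - i) + (i - j))
      = (\<Prod>j\<in>{1..<i}. (j - i) + (i - j)) * (\<Prod>j\<in>{i<..k}. (j - i) + (i - j))"
    unfolding split by (rule prod.union_disjoint) auto
  also have "(\<Prod>j\<in>{1..<i}. (j - i) + (i - j)) = (\<Prod>j\<in>{1..i - 1}. j)"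
    by (rule prod.reindex_bij_witness[of _ "\<lambda>j. i - j" "\<lambda>j. i - j"]) auto
  also have "(\<Prod>j\<in>{i<..k}. (j - i) + (i - j)) = (\<Prod>j\<in>{1..k - i}. j)"
    by (rule prod.reindex_bij_witness[of _ "\<lambda>j. j + i" "\<lambda>j. j - i"]) auto
  finally show ?thesis
    by (simp add: fact_prod)
qed

lemma prod_add_eq_fact_binomial:
  fixes m k :: nat
  shows "(\<Prod>j\<in>{1..k}. m + j) = fact k * ((m + k) choose k)"
proof -
  have "fact m * (\<Prod>j\<in>{1..k}. m + j) = fact (m + k)"
    by (induction k) (simp_all add: algebra_simps)
  also have "\<dots> = fact m * (fact k * ((m + k) choose k))"
    using binomial_fact_lemma[of k "m + k"] by (simp add: algebra_simps)
  finally show ?thesis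
    by simp
qed

lemma dvd_dist_nat:
  fixes d m i j :: nat
  assumes "d dvd m + i" and "d dvd m + j"
  shows "d dvd (j - i) + (i - j)"
  using dvd_diff_nat[OF assms(1,2)] dvd_diff_nat[OF assms(2,1)] by auto

lemma dvd_add_dist_nat:
  fixes d m i j :: nat
  assumes "d dvd m + i" and "d dvd (j - i) + (i - j)"
  shows "d dvd m + j"
proof (cases "i \<le> j")
  case True
  then show ?thesis
    using dvd_add[OF assms] by simp
next
  case False
  then show ?thesis
    using dvd_diff_nat[OF assms] by simp
qed

section \<open>Valuations of binomial coefficients\<close>

lemma multiplicity_prod_others_le:
  fixes p m i k :: nat
  assumes "prime p" and i: "i \<in> {1..k}"
    and max: "\<And>j. j \<in> {1..k} \<Longrightarrow> multiplicity p (m + j) \<le> multiplicity p (m + i)"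
  shows "multiplicity p (\<Prod>j\<in>{1..k} - {i}. m + j) \<le> multiplicity p (fact (i - 1) * fact (k - i))"
proof -
  have "multiplicity p (\<Prod>j\<in>{1..k} - {i}. m + j)
      = (\<Sum>j\<in>{1..k} - {i}. multiplicity p (m + j))"
    using assms(1) by (intro prime_elem_multiplicity_prod_distrib) auto
  also have "\<dots> \<le> (\<Sum>j\<in>{1..k} - {i}. multiplicity p ((j - i) + (i - j)))"
  proof (rule sum_mono)
    fix j assume j: "j \<in> {1..k} - {i}"
    \<comment> \<open>By maximality at \<open>i\<close> this power divides \<open>m + i\<close> as
      well as \<open>m + j\<close>, hence their distance.\<close>
    have "p ^ multiplicity p (m + j) dvd (j - i) + (i - j)"
      using max[of j] j by (intro dvd_dist_nat[of _ m]) (auto intro: multiplicity_dvd multiplicity_dvd')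
    then show "multiplicity p (m + j) \<le> multiplicity p ((j - i) + (i - j))"
      using j assms(1) by (intro multiplicity_geI) (auto simp: not_prime_unit)
  qed
  also have "\<dots> = multiplicity p (\<Prod>j\<in>{1..k} - {i}. (j - i) + (i - j))"
    using assms(1) by (intro prime_elem_multiplicity_prod_distrib[symmetric]) auto
  finally show ?thesis
    using prod_dist_eq_fact[OF i] by simp
qed

lemma multiplicity_binomial_split:
  fixes p m i k :: nat
  assumes "prime p" and i: "i \<in> {1..k}"
  shows "multiplicity p ((m + k) choose k) + multiplicity p (fact k)
    = multiplicity p (m + i) + multiplicity p (\<Prod>j\<in>{1..k} - {i}. m + j)"
proof -
  have "((m + k) choose k) * fact k = (m + i) * (\<Prod>j\<in>{1..k} - {i}. m + j)"
    using prod_add_eq_fact_binomial[of m k] prod.remove[OF _ i, of "\<lambda>j. m + j"]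
    by (simp add: mult.commute)
  then have "multiplicity p (((m + k) choose k) * fact k)
      = multiplicity p ((m + i) * (\<Prod>j\<in>{1..k} - {i}. m + j))"
    by simp
  then show ?thesis
    using assms by (simp add: prime_elem_multiplicity_mult_distrib)
qed

text \<open>Here \<open>i * (k choose i)\<close> is the share of \<open>fact k\<close> that remains
  once the factors \<open>m + j\<close> with \<open>j \<noteq> i\<close> have been compared with
  \<open>fact (i - 1) * fact (k - i)\<close>.\<close>

lemma multiplicity_fact_split:
  fixes p i k :: nat
  assumes "prime p" and i: "i \<in> {1..k}"
  shows "multiplicity p (fact k :: nat)
    = multiplicity p (fact (i - 1) * fact (k - i) :: nat) + multiplicity p (i * (k choose i))"
proof -
  have "fact i = i * (fact (i - 1) :: nat)"
    using i by (cases i) auto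
  then have "(fact k :: nat) = (fact (i - 1) * fact (k - i)) * (i * (k choose i))"
    using binomial_fact_lemma[of i k] i by (simp add: algebra_simps)
  moreover have "k choose i \<noteq> 0"
    using i by simp
  ultimately show ?thesis
    using assms by (simp add: prime_elem_multiplicity_mult_distrib)
qed

lemma exists_max_multiplicity:
  fixes p m k :: nat
  assumes "k > 0"
  obtains i where "i \<in> {1..k}"
    "\<And>j. j \<in> {1..k} \<Longrightarrow> multiplicity p (m + j) \<le> multiplicity p (m + i)"
proof -
  let ?f = "\<lambda>i. multiplicity p (m + i)"
  have "Max (?f ` {1..k}) \<in> ?f ` {1..k}"
    using assms by (intro Max_in) auto
  then obtain i where "i \<in> {1..k}" "Max (?f ` {1..k}) = ?f i"
    by blast
  moreover have "?f j \<le> Max (?f ` {1..k})" if "j \<in> {1..k}" for j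
    using that by (intro Max_ge) auto
  ultimately show thesis
    using that[of i] by simp
qed

text \<open>The extra factor \<open>k\<close> comes along because
  \<open>fact (i - 1) * fact (k - i)\<close> divides even \<open>fact (k - 1)\<close>. It makes the
  bound applicable to \<open>i * (n choose i)\<close>.\<close>

lemma multiplicity_binomial_le:
  fixes p m i k :: nat
  assumes "prime p" and i: "i \<in> {1..k}"
    and max: "\<And>j. j \<in> {1..k} \<Longrightarrow> multiplicity p (m + j) \<le> multiplicity p (m + i)"
  shows "multiplicity p (k * ((m + k) choose k)) \<le> multiplicity p (m + i)"
proof -
  have "fact (i - 1) * fact (k - i) dvd (fact (i - 1 + (k - i)) :: nat)"
    by (rule fact_fact_dvd_fact)
  also have "i - 1 + (k - i) = k - 1"
    using i by auto
  finally have "multiplicity p (fact (i - 1) * fact (k - i)) \<le> multiplicity p (fact (k - 1) :: nat)"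
    by (intro dvd_imp_multiplicity_le) auto
  moreover have "multiplicity p (fact k :: nat) = multiplicity p (fact (k - 1) :: nat) + multiplicity p k"
    using multiplicity_fact_split[OF assms(1), of k k] i by simp
  moreover have "multiplicity p (k * ((m + k) choose k))
      = multiplicity p k + multiplicity p ((m + k) choose k)"
    using assms(1) i by (intro prime_elem_multiplicity_mult_distrib) auto
  ultimately show ?thesis
    using multiplicity_binomial_split[OF assms(1,2), of m] multiplicity_prod_others_le[OF assms]
    by linarith
qed

text \<open>The preceding bound is applied to the \<open>i\<close> consecutive numbers
  \<open>n - i + 1\<close>, ..., \<open>n\<close>: the prime power divides one of them, and each is
  positive and at most \<open>n\<close>.\<close>

lemma prime_power_multiplicity_binomial_le:
  fixes p i n :: nat
  assumes "prime p" and i: "i \<in> {1..n}"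
  shows "p ^ multiplicity p (i * (n choose i)) \<le> n"
proof -
  obtain l where l: "l \<in> {1..i}"
    "\<And>j. j \<in> {1..i} \<Longrightarrow> multiplicity p (n - i + j) \<le> multiplicity p (n - i + l)"
    using exists_max_multiplicity[of i p "n - i"] i by auto
  have "multiplicity p (i * (n choose i)) \<le> multiplicity p (n - i + l)"
    using multiplicity_binomial_le[OF assms(1) l] i by simp
  then have "p ^ multiplicity p (i * (n choose i)) dvd n - i + l"
    by (rule multiplicity_dvd')
  then have "p ^ multiplicity p (i * (n choose i)) \<le> n - i + l"
    using l(1) by (intro dvd_imp_le) auto
  also have "\<dots> \<le> n"
    using l(1) i by auto
  finally show ?thesis .
qed

section \<open>Prime powers exceeding \<open>n\<close>\<close>

lemma prime_power_large_imp_unique_max: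
  fixes p m i j n :: nat
  assumes "i \<in> {1..n}" and "j \<in> {1..n}" and "i \<noteq> j"
    and large: "n < p ^ multiplicity p (m + i)"
  shows "multiplicity p (m + j) < multiplicity p (m + i)"
proof (rule ccontr)
  assume "\<not> multiplicity p (m + j) < multiplicity p (m + i)"
  then have "p ^ multiplicity p (m + i) dvd (j - i) + (i - j)"
    by (intro dvd_dist_nat[of _ m]) (auto intro: multiplicity_dvd multiplicity_dvd')
  then have "p ^ multiplicity p (m + i) \<le> (j - i) + (i - j)"
    using assms(3) by (intro dvd_imp_le) auto
  then show False
    using large assms(1,2) by auto
qed

text \<open>In \<open>fact n\<close>, the part \<open>fact (i - 1) * fact (n - i)\<close> is
  absorbed by the factors other than \<open>m + i\<close>, and the rest,
  \<open>i * (n choose i)\<close>, has a \<open>p\<close>-part of at most \<open>n\<close>. As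
  \<open>m + i\<close> has a larger \<open>p\<close>-part, some power of \<open>p\<close> survives
  in the quotient.\<close>

lemma prime_power_large_imp_dvd_binomial:
  fixes p m i n :: nat
  assumes "prime p" and i: "i \<in> {1..n}" and large: "n < p ^ multiplicity p (m + i)"
  shows "multiplicity p ((m + n) choose n) > 0"
proof -
  have "multiplicity p (fact (i - 1) * fact (n - i))
      = multiplicity p (\<Prod>j\<in>{1..n} - {i}. (j - i) + (i - j))"
    using prod_dist_eq_fact[OF i] by simp
  also have "\<dots> = (\<Sum>j\<in>{1..n} - {i}. multiplicity p ((j - i) + (i - j)))"
    using assms(1) by (intro prime_elem_multiplicity_prod_distrib) auto
  also have "\<dots> \<le> (\<Sum>j\<in>{1..n} - {i}. multiplicity p (m + j))"
  proof (rule sum_mono)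
    fix j assume j: "j \<in> {1..n} - {i}"
    let ?d = "(j - i) + (i - j)"
    \<comment> \<open>The power of \<open>p\<close> in \<open>?d\<close> is at most
      \<open>?d < n\<close>, so it divides \<open>m + i\<close>; moving by \<open>?d\<close> carries
      the divisibility over to \<open>m + j\<close>.\<close>
    have "p ^ multiplicity p ?d \<le> ?d"
      using j by (intro dvd_imp_le multiplicity_dvd) auto
    also have "\<dots> < p ^ multiplicity p (m + i)"
      using large i j by auto
    finally have "multiplicity p ?d \<le> multiplicity p (m + i)"
      using prime_gt_1_nat[OF assms(1)] by simp
    then have "p ^ multiplicity p ?d dvd m + j"
      by (rule dvd_add_dist_nat[OF multiplicity_dvd' multiplicity_dvd])
    then show "multiplicity p ?d \<le> multiplicity p (m + j)"
      using j assms(1) by (intro multiplicity_geI) (auto simp: not_prime_unit)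
  qed
  also have "\<dots> = multiplicity p (\<Prod>j\<in>{1..n} - {i}. m + j)"
    using assms(1) by (intro prime_elem_multiplicity_prod_distrib[symmetric]) auto
  finally have "multiplicity p (fact (i - 1) * fact (n - i))
      \<le> multiplicity p (\<Prod>j\<in>{1..n} - {i}. m + j)" .
  moreover have "multiplicity p (i * (n choose i)) < multiplicity p (m + i)"
  proof -
    have "p ^ multiplicity p (i * (n choose i)) < p ^ multiplicity p (m + i)"
      using prime_power_multiplicity_binomial_le[OF assms(1,2)] large by linarith
    then show ?thesis
      using prime_gt_1_nat[OF assms(1)] by simp
  qed
  ultimately show ?thesis
    using multiplicity_binomial_split[OF assms(1,2), of m] multiplicity_fact_split[OF assms(1,2)]
    by linarith
qed

text \<open>The right-hand product is lcm(1, ..., \<open>n\<close>), and \<open>N\<close> divides it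
  prime by prime. Read contrapositively, a number above this product contains a prime power
  exceeding \<open>n\<close>.\<close>

lemma le_prod_prime_powers:
  fixes N n :: nat
  assumes "N > 0" and small: "\<And>p. prime p \<Longrightarrow> p ^ multiplicity p N \<le> n"
  shows "N \<le> (\<Prod>p | prime p \<and> p \<le> n. p ^ nat \<lfloor>log (real p) (real n)\<rfloor>)"
proof -
  have fin: "finite {p. prime p \<and> p \<le> n}"
    by (rule finite_subset[of _ "{..n}"]) auto
  have "N = (\<Prod>p\<in>prime_factors N. p ^ multiplicity p N)"
    using assms(1) by (rule prime_factorization_nat)
  also have "\<dots> dvd (\<Prod>p | prime p \<and> p \<le> n. p ^ nat \<lfloor>log (real p) (real n)\<rfloor>)"
  proof (rule prod_dvd_prod_subset2[OF fin])
    show "prime_factors N \<subseteq> {p. prime p \<and> p \<le> n}"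
    proof
      fix p assume "p \<in> prime_factors N"
      then have p: "prime p" "multiplicity p N > 0"
        by (auto simp: prime_factors_multiplicity)
      then have "p \<le> p ^ multiplicity p N"
        using prime_gt_1_nat[of p] by (intro self_le_power) auto
      with p small[of p] show "p \<in> {p. prime p \<and> p \<le> n}"
        by simp
    qed
  next
    fix p assume "p \<in> prime_factors N"
    then have p: "prime p"
      by (rule in_prime_factors_imp_prime)
    have "real p ^ multiplicity p N \<le> real n"
      using small[OF p] by (metis of_nat_le_iff of_nat_power)
    then have "real (multiplicity p N) \<le> log (real p) (real n)"
      using prime_gt_1_nat[OF p] by (intro le_log_of_power) auto
    then have "multiplicity p N \<le> nat \<lfloor>log (real p) (real n)\<rfloor>"
      by (simp add: le_nat_floor)
    then show "p ^ multiplicity p N dvd p ^ nat \<lfloor>log (real p) (real n)\<rfloor>"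
      by (rule le_imp_power_dvd)
  qed
  finally show ?thesis
    by (rule dvd_imp_le) (auto intro!: prod_pos simp: prime_gt_0_nat)
qed

section \<open>Construction of the coprime factors\<close>

theorem theorem1:
  fixes m n :: nat
  assumes "m > 0" and "n > 0"
    and "m > (\<Prod>p | prime p \<and> p \<le> n. p ^ nat \<lfloor>log (real p) (real n)\<rfloor>)"
  shows "\<exists>a :: nat \<Rightarrow> nat.
    (m + n) choose n = (\<Prod>i = 1..n. a i) \<and>
    (\<forall>i \<in> {1..n}. a i > 0 \<and> a i dvd m + i \<and> a i > 1) \<and>
    (\<forall>i \<in> {1..n}. \<forall>j \<in> {1..n}. i \<noteq> j \<longrightarrow> gcd (a i) (a j) = 1)"
proof -
  define C where "C = (m + n) choose n"
  have C: "C > 0"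
    by (simp add: C_def)
  have "\<exists>i\<in>{1..n}. \<forall>j\<in>{1..n}. multiplicity p (m + j) \<le> multiplicity p (m + i)" for p
    using exists_max_multiplicity[OF assms(2), of p m] by metis
  then obtain g where g: "\<And>p. g p \<in> {1..n}"
    and max: "\<And>p j. j \<in> {1..n} \<Longrightarrow> multiplicity p (m + j) \<le> multiplicity p (m + g p)"
    by metis
  \<comment> \<open>Each prime has just one index \<open>g p\<close>, so the sets \<open>P i\<close>
    partition the prime factors of \<open>C\<close>; this gives both the product formula and
    coprimality.\<close>
  define P where "P i = {p \<in> prime_factors C. g p = i}" for i
  define a where "a i = (\<Prod>p\<in>P i. p ^ multiplicity p C)" for i
  have P: "finite (P i)" "\<And>p. p \<in> P i \<Longrightarrow> prime p" for i
    by (auto simp: P_def)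
  have pos: "a i > 0" for i
    unfolding a_def using P by (intro prod_pos) (auto simp: prime_gt_0_nat)
  have "(\<Prod>i = 1..n. a i) = (\<Prod>p\<in>prime_factors C. p ^ multiplicity p C)"
    unfolding a_def P_def using g by (intro prod.group) auto
  then have prod: "C = (\<Prod>i = 1..n. a i)"
    using prime_factorization_nat[OF C] by simp
  have dvd: "a i dvd m + i" if "i \<in> {1..n}" for i
  proof (rule multiplicity_le_imp_dvd)
    fix p :: nat assume p: "prime p"
    have "multiplicity p C \<le> multiplicity p (n * C)"
      using C assms(2) by (intro dvd_imp_multiplicity_le) auto
    also have "\<dots> \<le> multiplicity p (m + g p)"
      unfolding C_def by (rule multiplicity_binomial_le[OF p g max])
    \<comment> \<open>The valuation of \<open>a i\<close> is that of \<open>C\<close> if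
      \<open>p \<in> P i\<close>, where \<open>g p = i\<close>, and 0 otherwise.\<close>
    finally show "multiplicity p (a i) \<le> multiplicity p (m + i)"
      unfolding a_def using multiplicity_prod_prime_powers[OF P p, of i] by (auto simp: P_def)
  qed (use pos[of i] in simp)
  have gt: "a i > 1" if i: "i \<in> {1..n}" for i
  proof -
    have "\<exists>p. prime p \<and> n < p ^ multiplicity p (m + i)"
    proof (rule ccontr)
      assume "\<nexists>p. prime p \<and> n < p ^ multiplicity p (m + i)"
      then have "p ^ multiplicity p (m + i) \<le> n" if "prime p" for p
        using that by (meson not_le)
      then have "m + i \<le> (\<Prod>p | prime p \<and> p \<le> n. p ^ nat \<lfloor>log (real p) (real n)\<rfloor>)"
        using assms(1) by (intro le_prod_prime_powers) auto
      with assms(3) show False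
        by linarith
    qed
    then obtain p where p: "prime p" and large: "n < p ^ multiplicity p (m + i)"
      by blast
    \<comment> \<open>Otherwise the valuation at \<open>g p\<close> would be strictly below that at
      \<open>i\<close>, against the choice of \<open>g p\<close>.\<close>
    have "g p = i"
      using prime_power_large_imp_unique_max[OF i g _ large] max[OF i, of p] by force
    moreover have v: "multiplicity p C > 0"
      unfolding C_def by (rule prime_power_large_imp_dvd_binomial[OF p i large])
    ultimately have "p \<in> P i"
      using p by (simp add: P_def prime_factors_multiplicity)
    then have "p ^ multiplicity p C dvd a i"
      unfolding a_def using P(1) by (intro dvd_prodI)
    then have "p ^ multiplicity p C \<le> a i"
      using pos by (rule dvd_imp_le)
    moreover have "1 < p ^ multiplicity p C"
      using prime_gt_1_nat[OF p] v by (rule one_less_power)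
    ultimately show ?thesis
      by simp
  qed
  have cop: "coprime (a i) (a j)" if "i \<noteq> j" for i j
    unfolding a_def
  proof (intro prod_coprime_left prod_coprime_right)
    fix p q assume "p \<in> P i" "q \<in> P j"
    moreover from this that have "p \<noteq> q"
      by (auto simp: P_def)
    ultimately show "coprime (p ^ multiplicity p C) (q ^ multiplicity q C)"
      using P by (simp add: primes_coprime)
  qed
  show ?thesis
    using prod pos dvd gt cop unfolding C_def by (intro exI[of _ a]) (auto simp: coprime_iff_gcd_eq_1)
qed

end
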